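(* Let $A\in\mathbb{S}^n$ have eigenvalue decomposition $$A=\begin{bmatrix}V_+&V_-\end{bmatrix}\begin{bmatrix}\Lambda_+&\\&\Lambda_-\end{bmatrix}\begin{bmatrix}V_+&V_-\end{bmatrix}^T,$$ where $[V_+\ V_-]$ is an $n\times n$ orthogonal (unitary) matrix and $\Lambda_+$, $\Lambda_-$ are diagonal matrices containing the positive and the non-positive eigenvalues of $A$ respectively. Then for any unitarily invariant norm $\|\cdot\|$, the matrix $V_+\Lambda_+V_+^T$ is a solution of $\min_{X\succeq 0}\|A-X\|$; that is, $\|A-V_+\Lambda_+V_+^T\|\le\|A-X\|$ for every positive semidefinite $X\in\mathbb{S}^n$.
   Context: $\mathbb{S}^n$ is the set of $n\times n$ Hermitian matrices (real symmetric in the real case), and $^T$ denotes the transpose (conjugate transpose in the complex case). A matrix norm is unitarily invariant if $\|UMW\|=\|M\|$ for all matrices $M$ and all unitary (orthogonal in the real case) $U,W$. $X\succeq 0$ means that $X$ is positive semidefinite. *)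

theory Defs
  imports "Jordan_Normal_Form.Schur_Decomposition"
begin

text \<open>
  The definitions are polymorphic in the scalars and are meant for \<^typ>\<open>real\<close> and
  \<^typ>\<open>complex\<close>. There \<^const>\<open>conjugate\<close> is the identity and complex conjugation,
  respectively, so \<^const>\<open>mat_adjoint\<close> is the transpose and the conjugate transpose.
  On \<^typ>\<open>complex\<close> the order is that of HOL-Library.Complex_Order: comparing
  a number with 0 includes the statement that it is real.
\<close>

definition hermitian_mat :: "nat \<Rightarrow> 'a :: conjugatable_field mat \<Rightarrow> bool" where
  "hermitian_mat n A \<longleftrightarrow> A \<in> carrier_mat n n \<and> mat_adjoint A = A"

definition unitary_mat :: "nat \<Rightarrow> 'a :: conjugatable_field mat \<Rightarrow> bool" where
  "unitary_mat n U \<longleftrightarrow> U \<in> carrier_mat n n \<and>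
     mat_adjoint U * U = 1\<^sub>m n \<and> U * mat_adjoint U = 1\<^sub>m n"

definition psd_mat :: "nat \<Rightarrow> 'a :: conjugatable_ordered_field mat \<Rightarrow> bool" where
  "psd_mat n X \<longleftrightarrow> hermitian_mat n X \<and>
     (\<forall>v \<in> carrier_vec n. 0 \<le> (X *\<^sub>v v) \<bullet>c v)"

text \<open>
  A norm on the vector space of n by n matrices, not assumed submultiplicative. Its values
  outside \<^term>\<open>carrier_mat n n\<close> are irrelevant.
\<close>

definition matrix_norm ::
  "nat \<Rightarrow> ('a :: {conjugatable_field, real_normed_field} mat \<Rightarrow> real) \<Rightarrow> bool" where
  "matrix_norm n N \<longleftrightarrow>
     (\<forall>M \<in> carrier_mat n n. 0 \<le> N M \<and> (N M = 0 \<longleftrightarrow> M = 0\<^sub>m n n)) \<and>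
     (\<forall>c. \<forall>M \<in> carrier_mat n n. N (c \<cdot>\<^sub>m M) = norm c * N M) \<and>
     (\<forall>M \<in> carrier_mat n n. \<forall>M' \<in> carrier_mat n n. N (M + M') \<le> N M + N M')"

definition unitarily_invariant_norm ::
  "nat \<Rightarrow> ('a :: {conjugatable_field, real_normed_field} mat \<Rightarrow> real) \<Rightarrow> bool" where
  "unitarily_invariant_norm n N \<longleftrightarrow> matrix_norm n N \<and>
     (\<forall>M \<in> carrier_mat n n. \<forall>U W. unitary_mat n U \<longrightarrow> unitary_mat n W \<longrightarrow> N (U * M * W) = N M)"

text \<open>The row \<open>[P Q]\<close> of two blocks with equally many rows; the lower blocks have no rows.\<close>

definition block_row :: "'a :: zero mat \<Rightarrow> 'a mat \<Rightarrow> 'a mat" where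
  "block_row P Q = four_block_mat P Q (0\<^sub>m 0 (dim_col P)) (0\<^sub>m 0 (dim_col Q))"

text \<open>
  The eigenvalue decomposition of \<open>A\<close>, with \<open>k\<close> positive and \<open>m\<close> non-positive eigenvalues
  (counted with multiplicity); \<open>k = 0\<close> and \<open>m = 0\<close> are allowed.
\<close>

definition signed_eigendecomposition ::
  "nat \<Rightarrow> nat \<Rightarrow> nat \<Rightarrow> 'a :: conjugatable_ordered_field mat \<Rightarrow>
   'a mat \<Rightarrow> 'a mat \<Rightarrow> 'a mat \<Rightarrow> 'a mat \<Rightarrow> bool" where
  "signed_eigendecomposition n k m A Vp Vm Lp Lm \<longleftrightarrow>
     k + m = n \<and>
     Vp \<in> carrier_mat n k \<and> Vm \<in> carrier_mat n m \<and>
     Lp \<in> carrier_mat k k \<and> diagonal_mat Lp \<and> (\<forall>i<k. 0 < Lp $$ (i, i)) \<and>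
     Lm \<in> carrier_mat m m \<and> diagonal_mat Lm \<and> (\<forall>i<m. Lm $$ (i, i) \<le> 0) \<and>
     unitary_mat n (block_row Vp Vm) \<and>
     A = block_row Vp Vm * four_block_mat Lp (0\<^sub>m k m) (0\<^sub>m m k) Lm
           * mat_adjoint (block_row Vp Vm)"

end

(* In the eigenbasis A is diagonal. For X positive semidefinite, a diagonal entry of V^* (A - X) V
   in a non-positive position i is lambda_i - x with x >= 0, so its modulus is at least |lambda_i|.
   Hence V^* (A - Vp Lp Vp^* ) V arises from V^* (A - X) V by deleting the off-diagonal entries and
   shrinking the diagonal ones. Deleting and shrinking are convex combinations of conjugations and
   multiplications by the unitary diag(1, .., 1, -1, 1, .., 1), so they do not increase N. *)
theory Submission
  imports Defs
begin

section \<open>Scalars common to the real and the complex case\<close>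

text \<open>
  Covers both scalar types of the theorem. The axioms use \<open>r *\<^sub>R 1\<close> because
  \<open>of_real\<close> is not available inside a class specification.
\<close>

class real_complex_scalar = conjugatable_ordered_field + real_normed_field +
  assumes nonneg_iff_scaleR: "0 \<le> x \<longleftrightarrow> (\<exists>r\<ge>0. x = r *\<^sub>R 1)"
    and conjugate_scaleR: "conjugate (r *\<^sub>R 1) = r *\<^sub>R 1"

instance real :: real_complex_scalar
  by standard auto

instance complex :: real_complex_scalar
proof
  fix x :: complex
  show "0 \<le> x \<longleftrightarrow> (\<exists>r\<ge>0. x = r *\<^sub>R 1)"
    by (auto simp: less_eq_complex_def complex_eq_iff)
qed auto

lemma nonneg_iff_of_real:
  fixes x :: "'a :: real_complex_scalar"
  shows "0 \<le> x \<longleftrightarrow> (\<exists>r\<ge>0. x = of_real r)"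
  unfolding of_real_def by (rule nonneg_iff_scaleR)

lemma conjugate_of_real: "conjugate (of_real r :: 'a :: real_complex_scalar) = of_real r"
  unfolding of_real_def by (rule conjugate_scaleR)

lemma nonneg_mult:
  fixes x y :: "'a :: real_complex_scalar"
  assumes "0 \<le> x" "0 \<le> y"
  shows "0 \<le> x * y"
proof -
  obtain r s where "0 \<le> r" "x = of_real r" "0 \<le> s" "y = of_real s"
    using assms unfolding nonneg_iff_of_real[of x] nonneg_iff_of_real[of y] by blast
  then show ?thesis
    unfolding nonneg_iff_of_real[of "x * y"] by (intro exI[of _ "r * s"]) simp
qed

lemma conjugate_nonneg:
  fixes x :: "'a :: real_complex_scalar"
  assumes "0 \<le> x"
  shows "conjugate x = x"
  using assms unfolding nonneg_iff_of_real[of x] by (auto simp: conjugate_of_real)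

text \<open>Subtracting \<open>y\<close> moves \<open>x\<close> further from 0 on the same side, so
  \<open>x\<close> is a fraction of \<open>x - y\<close>. This is where the sign of the non-positive
  eigenvalues enters.\<close>

lemma nonpos_contraction:
  fixes x y :: "'a :: real_complex_scalar"
  assumes "x \<le> 0" "0 \<le> y"
  shows "\<exists>t. \<bar>t\<bar> \<le> 1 \<and> x = of_real t * (x - y)"
proof -
  have "0 \<le> - x"
    using add_left_mono[OF assms(1), of "- x"] by simp
  then obtain r s where r: "0 \<le> r" "- x = of_real r" and s: "0 \<le> s" "y = of_real s"
    using assms(2) unfolding nonneg_iff_of_real[of "- x"] nonneg_iff_of_real[of y] by blast
  have x: "x = of_real (- r)"
    using r(2) by (metis minus_minus of_real_minus)
  have xy: "x - y = of_real (- (r + s))"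
    by (simp add: x s(2))
  show ?thesis
  proof (intro exI conjI)
    \<comment> \<open>If \<open>r + s = 0\<close>, then \<open>r = s = 0\<close>, and division by
      zero gives the factor 0, which still works.\<close>
    show "\<bar>r / (r + s)\<bar> \<le> 1"
      using r(1) s(1) by (cases "r + s = 0") auto
    have "- r = r / (r + s) * (- (r + s))"
      using r(1) s(1) by (cases "r + s = 0") (auto simp: field_simps)
    \<comment> \<open>Unfolding \<open>x\<close> also turns \<open>x - y\<close> into
      \<open>of_real (- r) - y\<close>, so \<open>xy\<close> has to be rewritten in the same way
      before it can apply.\<close>
    then show "x = of_real (r / (r + s)) * (x - y)"
      unfolding x xy[unfolded x] of_real_mult[symmetric] by simp
  qed
qed

section \<open>Adjoint matrices\<close>

lemma conjugate_one: "conjugate (1 :: 'a :: conjugatable_field) = 1"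
  by (metis conjugate_dist_mul conjugate_id mult.comm_neutral mult.left_neutral)

lemma dim_mat_adjoint [simp]:
  "dim_row (mat_adjoint A) = dim_col A"
  "dim_col (mat_adjoint A) = dim_row A"
  by (auto simp: mat_adjoint_def)

lemma mat_adjoint_carrier [simp]:
  "A \<in> carrier_mat n m \<Longrightarrow> mat_adjoint A \<in> carrier_mat m n"
  by (rule carrier_matI) auto

lemma index_mat_adjoint [simp]:
  assumes "i < dim_col A" "j < dim_row A"
  shows "mat_adjoint A $$ (i, j) = conjugate (A $$ (j, i))"
  using assms by (simp add: mat_adjoint_def mat_of_rows_index)

lemma mat_adjoint_adjoint [simp]: "mat_adjoint (mat_adjoint A) = A"
  by (rule eq_matI) auto

lemma mat_adjoint_mult:
  assumes "A \<in> carrier_mat n m" "B \<in> carrier_mat m l"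
  shows "mat_adjoint (A * B) = mat_adjoint B * mat_adjoint A"
proof (rule eq_matI)
  fix i j assume "i < dim_row (mat_adjoint B * mat_adjoint A)"
    "j < dim_col (mat_adjoint B * mat_adjoint A)"
  then show "mat_adjoint (A * B) $$ (i, j) = (mat_adjoint B * mat_adjoint A) $$ (i, j)"
    using assms
    by (simp add: scalar_prod_def sum_conjugate conjugate_dist_mul mult.commute[of "conjugate (A $$ _)"])
qed (use assms in auto)

text \<open>The characteristic property of the adjoint, by exchanging two finite sums.\<close>

lemma mult_mat_vec_sprod_conjugate:
  fixes A :: "'a :: conjugatable_field mat"
  assumes "A \<in> carrier_mat n m" "w \<in> carrier_vec m" "v \<in> carrier_vec n"
  shows "(A *\<^sub>v w) \<bullet>c v = w \<bullet>c (mat_adjoint A *\<^sub>v v)"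
proof -
  have "(A *\<^sub>v w) \<bullet>c v = (\<Sum>i<n. \<Sum>j<m. A $$ (i, j) * w $ j * conjugate (v $ i))"
    using assms by (simp add: scalar_prod_def sum_distrib_right atLeast0LessThan)
  also have "\<dots> = (\<Sum>j<m. \<Sum>i<n. A $$ (i, j) * w $ j * conjugate (v $ i))"
    by (rule sum.swap)
  also have "\<dots> = w \<bullet>c (mat_adjoint A *\<^sub>v v)"
    using assms
    by (simp add: scalar_prod_def sum_distrib_left sum_conjugate conjugate_dist_mul
        atLeast0LessThan ac_simps)
  finally show ?thesis .
qed

section \<open>Positive semidefinite matrices\<close>

text \<open>The quadratic form of the new matrix at \<open>v\<close> is that of \<open>X\<close> at
  \<open>V *\<^sub>v v\<close>. \<open>V\<close> may be rectangular: the theorem uses this once with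
  the unitary eigenbasis and once with the adjoint of \<open>Vp\<close>.\<close>

lemma psd_mat_congruence:
  fixes X :: "'a :: conjugatable_ordered_field mat"
  assumes X: "psd_mat n X" and V: "V \<in> carrier_mat n k"
  shows "psd_mat k (mat_adjoint V * X * V)"
proof -
  have Xc: "X \<in> carrier_mat n n" and Xa: "mat_adjoint X = X"
    and pos: "\<And>v. v \<in> carrier_vec n \<Longrightarrow> 0 \<le> (X *\<^sub>v v) \<bullet>c v"
    using X by (auto simp: psd_mat_def hermitian_mat_def)
  have Va: "mat_adjoint V \<in> carrier_mat k n"
    using V by simp
  have "mat_adjoint (mat_adjoint V * X * V) = mat_adjoint V * (X * V)"
    using mat_adjoint_mult[OF mult_carrier_mat[OF Va Xc] V] mat_adjoint_mult[OF Va Xc] by (simp add: Xa)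
  also have "\<dots> = mat_adjoint V * X * V"
    using assoc_mult_mat[OF Va Xc V] by simp
  finally have "hermitian_mat k (mat_adjoint V * X * V)"
    using V by (auto simp: hermitian_mat_def)
  moreover have "0 \<le> (mat_adjoint V * X * V *\<^sub>v v) \<bullet>c v" if v: "v \<in> carrier_vec k" for v
  proof -
    have Vv: "V *\<^sub>v v \<in> carrier_vec n"
      using V v by simp
    have "mat_adjoint V * X * V *\<^sub>v v = mat_adjoint V *\<^sub>v (X *\<^sub>v (V *\<^sub>v v))"
      using assoc_mult_mat_vec[OF mult_carrier_mat[OF Va Xc] V v] assoc_mult_mat_vec[OF Va Xc Vv]
      by simp
    also have "\<dots> \<bullet>c v = (X *\<^sub>v (V *\<^sub>v v)) \<bullet>c (V *\<^sub>v v)"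
      using mult_mat_vec_sprod_conjugate[OF Va mult_mat_vec_carrier[OF Xc Vv] v] by simp
    finally show ?thesis
      using pos[OF Vv] by simp
  qed
  ultimately show ?thesis
    by (simp add: psd_mat_def)
qed

text \<open>A diagonal entry is the value of the quadratic form at a unit vector.\<close>

lemma psd_mat_diagonal_nonneg:
  fixes X :: "'a :: conjugatable_ordered_field mat"
  assumes "psd_mat n X" "i < n"
  shows "0 \<le> X $$ (i, i)"
proof -
  have X: "X \<in> carrier_mat n n"
    using assms(1) by (auto simp: psd_mat_def hermitian_mat_def)
  have "conjugate (unit_vec n i :: 'a vec) = unit_vec n i"
    using assms(2) by (intro eq_vecI) (auto simp: unit_vec_def conjugate_one)
  then have "(X *\<^sub>v unit_vec n i) \<bullet>c unit_vec n i = X $$ (i, i)"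
    using X assms(2) by simp
  then show ?thesis
    using assms by (metis psd_mat_def unit_vec_carrier)
qed

text \<open>The quadratic form is the sum of the diagonal entries weighted by the squared moduli of
  the coordinates. Nonnegative scalars are real, which makes \<open>D\<close> self-adjoint.\<close>

lemma diagonal_psd_mat:
  fixes D :: "'a :: real_complex_scalar mat"
  assumes D: "D \<in> carrier_mat k k" "diagonal_mat D" and pos: "\<And>i. i < k \<Longrightarrow> 0 \<le> D $$ (i, i)"
  shows "psd_mat k D"
proof -
  have off: "D $$ (i, j) = 0" if "i < k" "j < k" "i \<noteq> j" for i j
    using D that by (auto simp: diagonal_mat_def)
  have "mat_adjoint D = D"
  proof (rule eq_matI)
    fix i j assume "i < dim_row D" "j < dim_col D"
    then show "mat_adjoint D $$ (i, j) = D $$ (i, j)"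
      using D(1) by (cases "i = j") (auto simp: off conjugate_nonneg[OF pos])
  qed (use D(1) in auto)
  moreover have "0 \<le> (D *\<^sub>v v) \<bullet>c v" if v: "v \<in> carrier_vec k" for v
  proof -
    have "(D *\<^sub>v v) $ i = D $$ (i, i) * v $ i" if "i < k" for i
    proof -
      have "(D *\<^sub>v v) $ i = (\<Sum>j<k. D $$ (i, j) * v $ j)"
        using D(1) v that by (simp add: scalar_prod_def atLeast0LessThan)
      also have "\<dots> = (\<Sum>j<k. if j = i then D $$ (i, i) * v $ i else 0)"
        using off that by (intro sum.cong) auto
      finally show ?thesis
        using that by simp
    qed
    then have "(D *\<^sub>v v) \<bullet>c v = (\<Sum>i<k. D $$ (i, i) * (v $ i * conjugate (v $ i)))"
      using D(1) v by (simp add: scalar_prod_def atLeast0LessThan mult.assoc)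
    then show ?thesis
      by (auto intro!: sum_nonneg nonneg_mult pos conjugate_square_positive)
  qed
  ultimately show ?thesis
    using D(1) by (auto simp: psd_mat_def hermitian_mat_def)
qed

section \<open>Reflections in one coordinate\<close>

definition flip_mat :: "nat \<Rightarrow> nat \<Rightarrow> 'a :: ring_1 mat" where
  "flip_mat n i = mat n n (\<lambda>(a, b). if a = b then (if a = i then - 1 else 1) else 0)"

lemma flip_mat_carrier [simp]: "flip_mat n i \<in> carrier_mat n n"
  by (simp add: flip_mat_def)

lemma flip_mat_dim [simp]: "dim_row (flip_mat n i) = n" "dim_col (flip_mat n i) = n"
  by (simp_all add: flip_mat_def)

lemma flip_mat_mult:
  fixes M :: "'a :: ring_1 mat"
  assumes "M \<in> carrier_mat n n"
  shows "flip_mat n i * M = mat n n (\<lambda>(a, b). if a = i then - M $$ (a, b) else M $$ (a, b))"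
proof (rule eq_matI; simp add: assms[THEN carrier_matD(2)])
  fix a b assume ab: "a < n" "b < n"
  have "row (flip_mat n i) a \<bullet> col M b = (\<Sum>j<n. flip_mat n i $$ (a, j) * M $$ (j, b))"
    using assms ab by (simp add: scalar_prod_def atLeast0LessThan)
  also have "\<dots> = (\<Sum>j<n. if j = a then (if a = i then - 1 else 1) * M $$ (a, b) else 0)"
    using ab by (intro sum.cong) (auto simp: flip_mat_def)
  finally have "row (flip_mat n i) a \<bullet> col M b = (if a = i then - 1 else 1) * M $$ (a, b)"
    using ab by simp
  then show "(a = i \<longrightarrow> row (flip_mat n i) i \<bullet> col M b = - M $$ (i, b)) \<and>
      (a \<noteq> i \<longrightarrow> row (flip_mat n i) a \<bullet> col M b = M $$ (a, b))"
    by auto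
qed

lemma mult_flip_mat:
  fixes M :: "'a :: ring_1 mat"
  assumes "M \<in> carrier_mat n n"
  shows "M * flip_mat n i = mat n n (\<lambda>(a, b). if b = i then - M $$ (a, b) else M $$ (a, b))"
proof (rule eq_matI; simp add: assms[THEN carrier_matD(1)])
  fix a b assume ab: "a < n" "b < n"
  have "row M a \<bullet> col (flip_mat n i) b = (\<Sum>j<n. M $$ (a, j) * flip_mat n i $$ (j, b))"
    using assms ab by (simp add: scalar_prod_def atLeast0LessThan)
  also have "\<dots> = (\<Sum>j<n. if j = b then M $$ (a, b) * (if b = i then - 1 else 1) else 0)"
    using ab by (intro sum.cong) (auto simp: flip_mat_def)
  finally have "row M a \<bullet> col (flip_mat n i) b = M $$ (a, b) * (if b = i then - 1 else 1)"
    using ab by simp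
  then show "(b = i \<longrightarrow> row M a \<bullet> col (flip_mat n i) i = - M $$ (a, i)) \<and>
      (b \<noteq> i \<longrightarrow> row M a \<bullet> col (flip_mat n i) b = M $$ (a, b))"
    by auto
qed

lemma unitary_one_mat: "unitary_mat n (1\<^sub>m n :: 'a :: conjugatable_field mat)"
proof -
  have "mat_adjoint (1\<^sub>m n :: 'a mat) = 1\<^sub>m n"
    by (rule eq_matI) (auto simp: conjugate_one)
  then show ?thesis
    by (simp add: unitary_mat_def)
qed

text \<open>A reflection is self-adjoint and its own inverse.\<close>

lemma unitary_flip_mat: "unitary_mat n (flip_mat n i :: 'a :: conjugatable_field mat)"
proof -
  have "mat_adjoint (flip_mat n i :: 'a mat) = flip_mat n i"
    by (rule eq_matI) (auto simp: flip_mat_def conjugate_neg conjugate_one)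
  moreover have "flip_mat n i * flip_mat n i = (1\<^sub>m n :: 'a mat)"
    unfolding flip_mat_mult[OF flip_mat_carrier] by (rule eq_matI) (auto simp: flip_mat_def)
  ultimately show ?thesis
    by (simp add: unitary_mat_def)
qed

lemma unitary_mat_adjoint: "unitary_mat n U \<Longrightarrow> unitary_mat n (mat_adjoint U)"
  by (simp add: unitary_mat_def)

section \<open>Shrinking a matrix under a unitarily invariant norm\<close>

text \<open>The weights are nonnegative and sum to 1. They are parametrized by their difference
  \<open>t\<close>: an entry whose sign is reversed in \<open>M'\<close> gets multiplied by
  \<open>t\<close>, and an entry common to both matrices is kept.\<close>

lemma matrix_norm_convex:
  fixes M :: "'a :: {conjugatable_field, real_normed_field} mat"
  assumes N: "matrix_norm n N" and M: "M \<in> carrier_mat n n" "M' \<in> carrier_mat n n"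
    and eq: "N M' = N M" and t: "\<bar>t\<bar> \<le> 1"
  shows "N (of_real ((1 + t) / 2) \<cdot>\<^sub>m M + of_real ((1 - t) / 2) \<cdot>\<^sub>m M') \<le> N M"
proof -
  have "N (of_real ((1 + t) / 2) \<cdot>\<^sub>m M + of_real ((1 - t) / 2) \<cdot>\<^sub>m M')
      \<le> N (of_real ((1 + t) / 2) \<cdot>\<^sub>m M) + N (of_real ((1 - t) / 2) \<cdot>\<^sub>m M')"
    using N M unfolding matrix_norm_def by (meson smult_carrier_mat)
  also have "\<dots> = \<bar>(1 + t) / 2\<bar> * N M + \<bar>(1 - t) / 2\<bar> * N M"
    using N M eq unfolding matrix_norm_def by (metis norm_of_real)
  also have "\<dots> = ((1 + t) / 2 + (1 - t) / 2) * N M"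
    using t by (simp add: distrib_right)
  finally show ?thesis
    by (simp add: add_divide_distrib[symmetric])
qed

text \<open>Two convex combinations. Averaging \<open>M\<close> with its conjugate under the
  reflection clears row and column \<open>i\<close> off the diagonal; mixing the result with its
  one-sided reflection then scales the remaining entry by \<open>t\<close>.\<close>

lemma invariant_norm_shrink_index:
  fixes M :: "'a :: {conjugatable_field, real_normed_field} mat"
  assumes N: "unitarily_invariant_norm n N" and M: "M \<in> carrier_mat n n" and t: "\<bar>t\<bar> \<le> 1"
  shows "N (mat n n (\<lambda>(a, b). if a = i \<or> b = i then (if a = b then of_real t * M $$ (a, b) else 0)
      else M $$ (a, b))) \<le> N M"
proof -
  have norm: "matrix_norm n N"
    and inv: "\<And>M U W. M \<in> carrier_mat n n \<Longrightarrow> unitary_mat n U \<Longrightarrow> unitary_mat n W \<Longrightarrow>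
      N (U * M * W) = N M"
    using N by (auto simp: unitarily_invariant_norm_def)
  define S :: "'a mat" where "S = flip_mat n i"
  \<comment> \<open>The average, written as the case \<open>t = 0\<close> so that
    \<open>matrix_norm_convex\<close> matches syntactically.\<close>
  define P where "P = of_real ((1 + 0) / 2) \<cdot>\<^sub>m M + of_real ((1 - 0) / 2) \<cdot>\<^sub>m (S * M * S)"
  \<comment> \<open>At \<open>(i, i)\<close> the two sign changes cancel.\<close>
  have SMS: "S * M * S = mat n n (\<lambda>(a, b). if (a = i) \<noteq> (b = i) then - M $$ (a, b) else M $$ (a, b))"
    using M unfolding S_def by (subst mult_flip_mat) (auto simp: flip_mat_mult)
  have P: "P = mat n n (\<lambda>(a, b). if (a = i) \<noteq> (b = i) then 0 else M $$ (a, b))"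
    unfolding P_def SMS using M by (intro eq_matI) (auto simp: algebra_simps)
  have "N P \<le> N M"
    unfolding P_def
    by (rule matrix_norm_convex[OF norm M])
      (use M in \<open>auto simp: S_def intro!: inv unitary_flip_mat\<close>)
  have Pc: "P \<in> carrier_mat n n"
    by (simp add: P)
  \<comment> \<open>Row \<open>i\<close> of \<open>P\<close> is zero off the diagonal, so reflecting
    from the left alone negates just the entry \<open>(i, i)\<close>.\<close>
  have SP: "S * P = mat n n (\<lambda>(a, b). if a = i then - P $$ (a, b) else P $$ (a, b))"
    using Pc unfolding S_def by (rule flip_mat_mult)
  have "N (S * P) = N P"
    using inv[OF Pc unitary_flip_mat unitary_one_mat, of i] by (simp add: S_def P)
  then have "N (of_real ((1 + t) / 2) \<cdot>\<^sub>m P + of_real ((1 - t) / 2) \<cdot>\<^sub>m (S * P)) \<le> N P"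
    by (intro matrix_norm_convex[OF norm Pc _ _ t]) (auto simp: S_def P)
  also have "of_real ((1 + t) / 2) \<cdot>\<^sub>m P + of_real ((1 - t) / 2) \<cdot>\<^sub>m (S * P) =
      mat n n (\<lambda>(a, b). if a = i \<or> b = i then (if a = b then of_real t * M $$ (a, b) else 0)
        else M $$ (a, b))"
    unfolding SP by (intro eq_matI) (auto simp: P field_simps)
  finally show ?thesis
    using \<open>N P \<le> N M\<close> by simp
qed

lemma invariant_norm_shrink_diagonal:
  fixes M :: "'a :: {conjugatable_field, real_normed_field} mat"
  assumes N: "unitarily_invariant_norm n N" and M: "M \<in> carrier_mat n n"
    and D: "D \<in> carrier_mat n n" "diagonal_mat D"
    and shrink: "\<And>i. i < n \<Longrightarrow> \<exists>t. \<bar>t\<bar> \<le> 1 \<and> D $$ (i, i) = of_real t * M $$ (i, i)"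
  shows "N D \<le> N M"
proof -
  \<comment> \<open>Interpolates from \<open>M\<close> at \<open>j = 0\<close> to \<open>D\<close>
    at \<open>j = n\<close>, treating one index at a time.\<close>
  define E where "E j = mat n n (\<lambda>(a, b). if a < j \<or> b < j then D $$ (a, b) else M $$ (a, b))" for j
  have "j \<le> n \<Longrightarrow> N (E j) \<le> N M" for j
  proof (induction j)
    case 0
    have "E 0 = M"
      using M by (intro eq_matI) (auto simp: E_def)
    then show ?case
      by simp
  next
    case (Suc j)
    then have j: "j < n"
      by simp
    obtain t where t: "\<bar>t\<bar> \<le> 1" "D $$ (j, j) = of_real t * M $$ (j, j)"
      using shrink[OF j] by blast
    have off: "D $$ (a, b) = 0" if "a < n" "b < n" "a \<noteq> b" for a b
      using D that by (auto simp: diagonal_mat_def)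
    \<comment> \<open>The entry \<open>(j, j)\<close> of \<open>E j\<close> is still that of
      \<open>M\<close>, so the factor \<open>t\<close> turns it into that of \<open>D\<close>; the
      other entries of row and column \<open>j\<close> become 0, as in the diagonal matrix
      \<open>D\<close>.\<close>
    have "E (Suc j) = mat n n (\<lambda>(a, b). if a = j \<or> b = j
        then (if a = b then of_real t * E j $$ (a, b) else 0) else E j $$ (a, b))"
      by (rule eq_matI) (auto simp: E_def less_Suc_eq t(2) off)
    then have "N (E (Suc j)) \<le> N (E j)"
      using invariant_norm_shrink_index[OF N _ t(1), of "E j" j] by (simp add: E_def)
    then show ?case
      using Suc by simp
  qed
  moreover have "E n = D"
    using D by (intro eq_matI) (auto simp: E_def)
  ultimately show ?thesis
    by (metis order_refl)
qed

section \<open>Block form of the positive part, and optimality\<close>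

text \<open>Expresses the positive part in the full eigenbasis, so that it can be subtracted from
  \<open>A\<close> between the same unitary factors.\<close>

lemma block_row_mult_first_block:
  fixes P :: "'a :: conjugatable_field mat"
  assumes P: "P \<in> carrier_mat n k" and Q: "Q \<in> carrier_mat n m" and L: "L \<in> carrier_mat k k"
  shows "block_row P Q * four_block_mat L (0\<^sub>m k m) (0\<^sub>m m k) (0\<^sub>m m m) * mat_adjoint (block_row P Q)
    = P * L * mat_adjoint P"
proof -
  \<comment> \<open>The lower blocks of \<open>block_row\<close> have no rows, so the right blocks
    of its adjoint have no columns.\<close>
  have adj: "mat_adjoint (block_row P Q) =
      four_block_mat (mat_adjoint P) (0\<^sub>m k 0) (mat_adjoint Q) (0\<^sub>m m 0)"
    using P Q by (intro eq_matI) (auto simp: block_row_def)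
  have "block_row P Q * four_block_mat L (0\<^sub>m k m) (0\<^sub>m m k) (0\<^sub>m m m) =
      four_block_mat (P * L) (0\<^sub>m n m) (0\<^sub>m 0 k) (0\<^sub>m 0 m)"
    unfolding block_row_def using P Q L
    by (subst mult_four_block_mat[of _ n k _ m _ 0 _ _ k _ m]) auto
  moreover have "\<dots> * mat_adjoint (block_row P Q) =
      four_block_mat (P * L * mat_adjoint P) (0\<^sub>m n 0) (0\<^sub>m 0 n) (0\<^sub>m 0 0)"
    unfolding adj using P Q L
    by (subst mult_four_block_mat[of _ n k _ m _ 0 _ _ n _ 0]) auto
  moreover have "\<dots> = P * L * mat_adjoint P"
    using P L by (intro eq_matI) auto
  ultimately show ?thesis
    by simp
qed

theorem positive_part_best_approximation:
  fixes A :: "'a :: real_complex_scalar mat"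
  assumes decomp: "signed_eigendecomposition n k m A Vp Vm Lp Lm"
    and N: "unitarily_invariant_norm n N"
  shows "psd_mat n (Vp * Lp * mat_adjoint Vp)"
    and "psd_mat n X \<Longrightarrow> N (A - Vp * Lp * mat_adjoint Vp) \<le> N (A - X)"
proof -
  have km: "k + m = n" and Vp: "Vp \<in> carrier_mat n k" and Vm: "Vm \<in> carrier_mat n m"
    and Lp: "Lp \<in> carrier_mat k k" "diagonal_mat Lp" "\<And>i. i < k \<Longrightarrow> 0 < Lp $$ (i, i)"
    and Lm: "Lm \<in> carrier_mat m m" "diagonal_mat Lm" "\<And>i. i < m \<Longrightarrow> Lm $$ (i, i) \<le> 0"
    using decomp by (auto simp: signed_eigendecomposition_def)
  define V where "V = block_row Vp Vm"
  define L where "L = four_block_mat Lp (0\<^sub>m k m) (0\<^sub>m m k) Lm"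
  \<comment> \<open>In the eigenbasis, \<open>L\<close> represents \<open>A\<close>,
    \<open>E\<close> its positive part, and \<open>D\<close> the residual
    \<open>L - E\<close>.\<close>
  define D where "D = four_block_mat (0\<^sub>m k k) (0\<^sub>m k m) (0\<^sub>m m k) Lm"
  define E where "E = four_block_mat Lp (0\<^sub>m k m) (0\<^sub>m m k) (0\<^sub>m m m)"
  have U: "unitary_mat n V" and A: "A = V * L * mat_adjoint V"
    using decomp by (auto simp: signed_eigendecomposition_def V_def L_def)
  have V: "V \<in> carrier_mat n n" and VV: "mat_adjoint V * V = 1\<^sub>m n"
    using U by (auto simp: unitary_mat_def)
  have Va: "mat_adjoint V \<in> carrier_mat n n"
    using V by simp
  have L: "L \<in> carrier_mat n n" and D: "D \<in> carrier_mat n n" and E: "E \<in> carrier_mat n n"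
    using Lp(1) Lm(1) by (simp_all add: L_def D_def E_def km[symmetric])
  have inv: "\<And>M U W. M \<in> carrier_mat n n \<Longrightarrow> unitary_mat n U \<Longrightarrow> unitary_mat n W \<Longrightarrow>
      N (U * M * W) = N M"
    using N by (auto simp: unitarily_invariant_norm_def)

  have "psd_mat k Lp"
    using Lp by (intro diagonal_psd_mat) (auto intro: less_imp_le)
  then show "psd_mat n (Vp * Lp * mat_adjoint Vp)"
    using psd_mat_congruence[of k Lp "mat_adjoint Vp" n] Vp by simp

  assume X: "psd_mat n X"
  then have Xc: "X \<in> carrier_mat n n"
    by (auto simp: psd_mat_def hermitian_mat_def)
  \<comment> \<open>The competitor \<open>X\<close> in the eigenbasis; only its diagonal will
    matter, which congruence keeps nonnegative.\<close>
  define Y where "Y = mat_adjoint V * X * V"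
  have Y: "Y \<in> carrier_mat n n"
    using V by (auto simp: Y_def)
  have Ypos: "0 \<le> Y $$ (i, i)" if "i < n" for i
    using psd_mat_diagonal_nonneg[OF psd_mat_congruence[OF X V] that] by (simp add: Y_def)

  have "A - Vp * Lp * mat_adjoint Vp = V * L * mat_adjoint V - V * E * mat_adjoint V"
    using block_row_mult_first_block[OF Vp Vm Lp(1)] by (simp add: A V_def E_def)
  also have "\<dots> = V * (L - E) * mat_adjoint V"
    using V Va L E
    by (simp add: minus_mult_distrib_mat[of _ n n _ _ n] mult_minus_distrib_mat[of _ n n _ n])
  also have "L - E = D"
    using Lp(1) Lm(1) by (intro eq_matI) (auto simp: L_def E_def D_def)
  finally have lhs: "N (A - Vp * Lp * mat_adjoint Vp) = N D"
    using inv[OF D U unitary_mat_adjoint[OF U]] by simp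

  have Ac: "A \<in> carrier_mat n n"
    using V L by (auto simp: A)
  \<comment> \<open>Passing to the eigenbasis reduces the claim to comparing \<open>D\<close> with
    \<open>L - Y\<close>.\<close>
  have "mat_adjoint V * A = L * mat_adjoint V"
    using assoc_mult_mat[OF V L Va] assoc_mult_mat[OF Va V mult_carrier_mat[OF L Va]] L Va
    by (simp add: A VV)
  then have "mat_adjoint V * A * V = L"
    using assoc_mult_mat[OF L Va V] L by (simp add: VV)
  then have "mat_adjoint V * (A - X) * V = L - Y"
    unfolding Y_def mult_minus_distrib_mat[OF Va Ac Xc]
    by (simp only: minus_mult_distrib_mat[OF mult_carrier_mat[OF Va Ac] mult_carrier_mat[OF Va Xc] V])
  then have rhs: "N (A - X) = N (L - Y)"
    using inv[OF minus_carrier_mat[OF Xc] unitary_mat_adjoint[OF U] U, of A] by simp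

  have "N D \<le> N (L - Y)"
  proof (rule invariant_norm_shrink_diagonal[OF N _ D])
    show "diagonal_mat D"
      using Lm(1,2) by (auto simp: D_def diagonal_mat_def)
    show "\<exists>t. \<bar>t\<bar> \<le> 1 \<and> D $$ (i, i) = of_real t * (L - Y) $$ (i, i)" if i: "i < n" for i
    \<comment> \<open>At positive eigenvalues the residual vanishes, so the factor 0 serves. At the
      others \<open>L\<close> and \<open>D\<close> agree, and the entry of \<open>L - Y\<close> is a
      non-positive number minus a nonnegative one.\<close>
    proof (cases "i < k")
      case True
      then have "D $$ (i, i) = 0"
        using Lm(1) i km by (simp add: D_def)
      then show ?thesis
        by (intro exI[of _ 0]) simp
    next
      case False
      then have "L $$ (i, i) = D $$ (i, i)" "D $$ (i, i) \<le> 0"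
        using Lp(1) Lm(1) Lm(3)[of "i - k"] i km by (auto simp: D_def L_def)
      then show ?thesis
        using nonpos_contraction[OF _ Ypos[OF i], of "D $$ (i, i)"] Y i by simp
    qed
  qed (rule minus_carrier_mat[OF Y])
  then show "N (A - Vp * Lp * mat_adjoint Vp) \<le> N (A - X)"
    by (simp add: lhs rhs)
qed

theorem lemma2p1:
  shows
    "(\<forall>(n::nat) (k::nat) (m::nat) (A::complex mat) Vp Vm Lp Lm (N::complex mat \<Rightarrow> real).
        hermitian_mat n A \<longrightarrow>
        signed_eigendecomposition n k m A Vp Vm Lp Lm \<longrightarrow>
        unitarily_invariant_norm n N \<longrightarrow>
        psd_mat n (Vp * Lp * mat_adjoint Vp) \<and>
        (\<forall>X. psd_mat n X \<longrightarrow> N (A - Vp * Lp * mat_adjoint Vp) \<le> N (A - X)))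
     \<and>
     (\<forall>(n::nat) (k::nat) (m::nat) (A::real mat) Vp Vm Lp Lm (N::real mat \<Rightarrow> real).
        hermitian_mat n A \<longrightarrow>
        signed_eigendecomposition n k m A Vp Vm Lp Lm \<longrightarrow>
        unitarily_invariant_norm n N \<longrightarrow>
        psd_mat n (Vp * Lp * mat_adjoint Vp) \<and>
        (\<forall>X. psd_mat n X \<longrightarrow> N (A - Vp * Lp * mat_adjoint Vp) \<le> N (A - X)))"
  by (blast intro: positive_part_best_approximation)

end
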